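(* Let $X\ne\{0\}$ be a complex Banach space with open unit ball $B_X$. Let $k,m,s,t\in\mathbb{N}$ with $0<t<s$, let $p\in(0,2]$ and $\lambda\in(0,\infty)$, and let $R_2=R^{p,m,k}_{\lambda,s,t}$ be the unique root in $(0,1)$ of the equation $\Psi_2(r)=0$, where $$\Psi_2(r)=2\lambda\frac{r^{k(s+t)}}{1-r^{ks}}-p\,\frac{1-r^m}{1+r^m}.$$ Let $f:B_X\to\mathbb{D}$ be holomorphic with homogeneous polynomial expansion $f(z)=\sum_{j=0}^\infty P_j(z)$, $z\in B_X$. For $n\in\mathbb{N}$ let $\mu_n:B_X\to B_X$ be a Schwarz mapping having a zero of order $n$ at $z=0$. Then $$H_f(z):=|f(\mu_m(z))|^p+\lambda\sum_{j=1}^\infty|P_{sj+t}(\mu_k(z))|\le1\qquad\text{for }\|z\|=r\le R_2 .$$ In the case when $\Psi_2(r)>0$ in some interval $(R_2,R_2+\varepsilon)$, $\varepsilon>0$, the number $R_2$ cannot be improved: for every $R\in(R_2,1)$ there exist such $f$ and $\mu_n$ ($n\ge1$) and a point $z\in B_X$ with $\|z\|\le R$ such that $H_f(z)>1$.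
   Context: $\mathbb{N}=\{1,2,\dots\}$ and $\mathbb{D}=\{z\in\mathbb{C}:|z|<1\}$. A homogeneous polynomial of degree $j$ on $X$ is a map $P_j(x)=u(x,\dots,x)$ for a (continuous) $j$-linear map $u$ on $X^j$; $P_0$ is the constant $f(0)$. Every holomorphic $f:B_X\to\mathbb{D}$ has a unique expansion $f(z)=\sum_{j\ge0}P_j(z)$ on $B_X$ with $P_j$ homogeneous of degree $j$. A Schwarz mapping is a holomorphic map $\mu:B_X\to B_X$ with $\mu(0)=0$; it has a zero of order $n$ at $0$ if the first non-zero term of its homogeneous polynomial expansion at $0$ has degree $n$. *)

theory Defs
  imports "HOL-Analysis.Analysis"
begin

class complex_normed_vector = real_normed_vector +
  fixes scaleC :: "complex \<Rightarrow> 'a \<Rightarrow> 'a"  (infixr "*\<^sub>C" 75)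
  assumes scaleC_add_right: "a *\<^sub>C (x + y) = a *\<^sub>C x + a *\<^sub>C y"
    and scaleC_add_left: "(a + b) *\<^sub>C x = a *\<^sub>C x + b *\<^sub>C x"
    and scaleC_scaleC: "a *\<^sub>C (b *\<^sub>C x) = (a * b) *\<^sub>C x"
    and scaleR_scaleC: "r *\<^sub>R x = complex_of_real r *\<^sub>C x"
    and norm_scaleC: "norm (a *\<^sub>C x) = cmod a * norm x"

class complex_banach = complex_normed_vector + complete_space

instantiation complex :: complex_banach
begin

definition scaleC_complex :: "complex \<Rightarrow> complex \<Rightarrow> complex"
  where "scaleC_complex a x = a * x"

instance
  by standard (auto simp: scaleC_complex_def algebra_simps scaleR_conv_of_real norm_mult)

end

text \<open>Complex Frechet differentiability at every point of \<open>S\<close>; used for open \<open>S\<close> only.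
  Boundedness and real linearity of \<open>L\<close> are part of \<open>has_derivative\<close>.\<close>

definition holomorphic_map_on ::
    "('a::complex_normed_vector \<Rightarrow> 'b::complex_normed_vector) \<Rightarrow> 'a set \<Rightarrow> bool"
  where "holomorphic_map_on f S \<longleftrightarrow>
    (\<forall>x\<in>S. \<exists>L. (f has_derivative L) (at x) \<and> (\<forall>c h. L (c *\<^sub>C h) = c *\<^sub>C L h))"

text \<open>The power \<open>X\<^sup>j\<close> is the set of functions on \<open>{..<j}\<close>, extended by \<open>undefined\<close>;
  the product topology on \<open>nat \<Rightarrow> 'a\<close> induces the product topology of \<open>X\<^sup>j\<close> on it.\<close>

definition continuous_multilinear ::
    "nat \<Rightarrow> ((nat \<Rightarrow> 'a::complex_normed_vector) \<Rightarrow> 'b::complex_normed_vector) \<Rightarrow> bool"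
  where "continuous_multilinear j u \<longleftrightarrow>
    (\<forall>x\<in>{..<j} \<rightarrow>\<^sub>E UNIV. \<forall>i<j. \<forall>a b. u (x(i := a + b)) = u (x(i := a)) + u (x(i := b))) \<and>
    (\<forall>x\<in>{..<j} \<rightarrow>\<^sub>E UNIV. \<forall>i<j. \<forall>c a. u (x(i := c *\<^sub>C a)) = c *\<^sub>C u (x(i := a))) \<and>
    continuous_on ({..<j} \<rightarrow>\<^sub>E UNIV) u"

definition homogeneous_polynomial ::
    "nat \<Rightarrow> ('a::complex_normed_vector \<Rightarrow> 'b::complex_normed_vector) \<Rightarrow> bool"
  where "homogeneous_polynomial j P \<longleftrightarrow>
    (\<exists>u. continuous_multilinear j u \<and> (\<forall>x. P x = u (\<lambda>i\<in>{..<j}. x)))"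

definition homogeneous_expansion ::
    "('a::complex_normed_vector \<Rightarrow> 'b::complex_normed_vector) \<Rightarrow> (nat \<Rightarrow> 'a \<Rightarrow> 'b) \<Rightarrow> bool"
  where "homogeneous_expansion f P \<longleftrightarrow>
    (\<forall>j. homogeneous_polynomial j (P j)) \<and> (\<forall>z\<in>ball 0 1. (\<lambda>j. P j z) sums f z)"

definition schwarz_mapping :: "('a::complex_normed_vector \<Rightarrow> 'a) \<Rightarrow> bool"
  where "schwarz_mapping \<mu> \<longleftrightarrow>
    holomorphic_map_on \<mu> (ball 0 1) \<and> \<mu> ` ball 0 1 \<subseteq> ball 0 1 \<and> \<mu> 0 = 0"

text \<open>The expansion is unique, so the existential quantifier refers to the expansion of \<open>\<mu>\<close>.\<close>

definition zero_of_order :: "('a::complex_normed_vector \<Rightarrow> 'b::complex_normed_vector) \<Rightarrow> nat \<Rightarrow> bool"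
  where "zero_of_order \<mu> n \<longleftrightarrow>
    (\<exists>Q. homogeneous_expansion \<mu> Q \<and> (\<forall>j<n. \<forall>z. Q j z = 0) \<and> (\<exists>z. Q n z \<noteq> 0))"

definition Psi2 :: "real \<Rightarrow> nat \<Rightarrow> nat \<Rightarrow> real \<Rightarrow> nat \<Rightarrow> nat \<Rightarrow> real \<Rightarrow> real"
  where "Psi2 p m k lam s t r =
    2 * lam * (r ^ (k * (s + t)) / (1 - r ^ (k * s))) - p * ((1 - r ^ m) / (1 + r ^ m))"

definition R2 :: "real \<Rightarrow> nat \<Rightarrow> nat \<Rightarrow> real \<Rightarrow> nat \<Rightarrow> nat \<Rightarrow> real"
  where "R2 p m k lam s t = (THE r. 0 < r \<and> r < 1 \<and> Psi2 p m k lam s t r = 0)"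

text \<open>\<open>f\<close> is a holomorphic map into the unit disc with expansion \<open>P\<close>, and \<open>\<mu> n\<close>, for \<open>n \<ge> 1\<close>,
  is a Schwarz mapping with a zero of order \<open>n\<close> at the origin.\<close>

definition admissible ::
    "('a::complex_banach \<Rightarrow> complex) \<Rightarrow> (nat \<Rightarrow> 'a \<Rightarrow> complex) \<Rightarrow> (nat \<Rightarrow> 'a \<Rightarrow> 'a) \<Rightarrow> bool"
  where "admissible f P \<mu> \<longleftrightarrow>
    holomorphic_map_on f (ball 0 1) \<and> f ` ball 0 1 \<subseteq> ball 0 1 \<and> homogeneous_expansion f P \<and>
    (\<forall>n\<ge>1. schwarz_mapping (\<mu> n) \<and> zero_of_order (\<mu> n) n)"

text \<open>The series over \<open>j \<ge> 1\<close> is indexed by \<open>Suc j\<close>.\<close>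

definition H_summand ::
    "nat \<Rightarrow> nat \<Rightarrow> nat \<Rightarrow> (nat \<Rightarrow> 'a \<Rightarrow> complex) \<Rightarrow> (nat \<Rightarrow> 'a \<Rightarrow> 'a) \<Rightarrow> 'a \<Rightarrow> nat \<Rightarrow> real"
  where "H_summand k s t P \<mu> z j = cmod (P (s * Suc j + t) (\<mu> k z))"

definition H :: "real \<Rightarrow> nat \<Rightarrow> nat \<Rightarrow> real \<Rightarrow> nat \<Rightarrow> nat \<Rightarrow> ('a \<Rightarrow> complex) \<Rightarrow>
    (nat \<Rightarrow> 'a \<Rightarrow> complex) \<Rightarrow> (nat \<Rightarrow> 'a \<Rightarrow> 'a) \<Rightarrow> 'a \<Rightarrow> real"
  where "H p m k lam s t f P \<mu> z =
    cmod (f (\<mu> m z)) powr p + lam * (\<Sum>j. H_summand k s t P \<mu> z j)"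

end

theory Submission
  imports Defs "HOL-Complex_Analysis.Conformal_Mappings"
begin

text \<open>
  Along a complex line \<open>w \<mapsto> w u\<close> with \<open>\<parallel>u\<parallel> \<le> 1\<close> the expansion of \<open>f\<close> is a power series in the unit
  disc, so the classical disc estimates give \<open>\<bar>P\<^sub>n(y)\<bar> \<le> (1 - \<bar>f(0)\<bar>\<^sup>2) \<parallel>y\<parallel>\<^sup>n\<close> and
  \<open>1 - \<bar>f(y)\<bar>\<^sup>2 \<ge> (1 - \<bar>f(0)\<bar>\<^sup>2) (1 - \<parallel>y\<parallel>) / (1 + \<parallel>y\<parallel>)\<close>; composing \<open>\<mu>\<^sub>n\<close> with a norming functional
  gives \<open>\<parallel>\<mu>\<^sub>n(z)\<parallel> \<le> \<parallel>z\<parallel>\<^sup>n\<close>. Bernoulli's inequality \<open>x\<^sup>p \<le> 1 - (p/2) (1 - x\<^sup>2)\<close>, where \<open>p \<le> 2\<close> enters,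
  then turns \<open>Psi2 \<le> 0\<close> into \<open>H \<le> 1\<close>. For sharpness take a unit vector \<open>v\<close>, a norming functional
  \<open>l\<close> of \<open>v\<close>, \<open>f = (a + l) / (1 + a l)\<close>, \<open>\<mu>\<^sub>n(z) = l(z)\<^sup>n\<^sup>-\<^sup>1 z\<close>, and let \<open>a \<rightarrow> 1\<close> at the point \<open>R v\<close>.
\<close>

subsection \<open>Norming functionals\<close>

text \<open>Homogeneity is required only as an inequality for positive factors, which is quick to
  check for infima; equality and the value 0 at 0 follow.\<close>

definition sublinear :: "('a::real_vector \<Rightarrow> real) \<Rightarrow> bool"
  where "sublinear p \<longleftrightarrow> (\<forall>x y. p (x + y) \<le> p x + p y) \<and> (\<forall>c>0. \<forall>x. p (c *\<^sub>R x) \<le> c * p x)"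

lemma sublinear_add: "sublinear p \<Longrightarrow> p (x + y) \<le> p x + p y"
  by (simp add: sublinear_def)

lemma sublinear_zero:
  assumes "sublinear p"
  shows "p 0 = 0"
proof -
  have "p (0 + 0) \<le> p 0 + p 0" "p ((1/2) *\<^sub>R 0) \<le> (1/2) * p 0"
    using assms unfolding sublinear_def by (blast, metis half_gt_zero_iff zero_less_one)
  then show ?thesis by simp
qed

lemma sublinear_scaleR:
  assumes "sublinear p" "0 \<le> c"
  shows "p (c *\<^sub>R x) = c * p x"
proof (cases "c = 0")
  case True
  then show ?thesis using sublinear_zero[OF assms(1)] by simp
next
  case False
  then have c: "0 < c" using assms(2) by simp
  have "p x = p (inverse c *\<^sub>R (c *\<^sub>R x))" using c by simp
  also have "\<dots> \<le> inverse c * p (c *\<^sub>R x)"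
    using assms(1) c unfolding sublinear_def by (meson positive_imp_inverse_positive)
  finally have "c * p x \<le> p (c *\<^sub>R x)" using c by (simp add: field_simps)
  moreover have "p (c *\<^sub>R x) \<le> c * p x" using assms(1) c unfolding sublinear_def by blast
  ultimately show ?thesis by simp
qed

lemma sublinear_minus: "sublinear p \<Longrightarrow> - p (- x) \<le> p x"
  using sublinear_add[of p x "- x"] sublinear_zero[of p] by simp

lemma sublinear_norm: "sublinear (norm :: 'a::real_normed_vector \<Rightarrow> real)"
  by (simp add: sublinear_def norm_triangle_ineq)

text \<open>Taking \<open>c = 0\<close> gives \<open>q \<le> p\<close>; taking \<open>c = 1\<close>
  at \<open>- y\<close> gives \<open>q (- y) \<le> - p y\<close>. Hence every linear functional
  below \<open>q\<close> is at least \<open>p y\<close> at \<open>y\<close>.\<close>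

lemma sublinear_tilt:
  fixes p :: "'a::real_vector \<Rightarrow> real"
  assumes p: "sublinear p"
  obtains q where "sublinear q" "\<And>x c. 0 \<le> c \<Longrightarrow> q x \<le> p (x + c *\<^sub>R y) - c * p y"
proof -
  define q where "q x = (INF c\<in>{0..}. p (x + c *\<^sub>R y) - c * p y)" for x
  have bdd: "bdd_below ((\<lambda>c. p (x + c *\<^sub>R y) - c * p y) ` {0..})" for x
  proof (rule bdd_belowI2)
    fix c :: real assume "c \<in> {0..}"
    \<comment> \<open>Splitting \<open>c y\<close> as \<open>(x + c y) + (- x)\<close> gives a lower
      bound independent of \<open>c\<close>, so the infimum is a genuine one.\<close>
    then have "c * p y = p ((x + c *\<^sub>R y) + (- x))" using sublinear_scaleR[OF p, of c y] by simp
    also have "\<dots> \<le> p (x + c *\<^sub>R y) + p (- x)" by (rule sublinear_add[OF p])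
    finally show "- p (- x) \<le> p (x + c *\<^sub>R y) - c * p y" by simp
  qed
  have le: "q x \<le> p (x + c *\<^sub>R y) - c * p y" if "0 \<le> c" for x c
    unfolding q_def using that by (intro cINF_lower[OF bdd]) auto
  have ge: "B \<le> q x" if "\<And>c. 0 \<le> c \<Longrightarrow> B \<le> p (x + c *\<^sub>R y) - c * p y" for B x
    unfolding q_def using that by (intro cINF_greatest) auto
  have add: "q (x + x') \<le> q x + q x'" for x x'
  proof -
    have "q (x + x') - q x \<le> p (x' + d *\<^sub>R y) - d * p y" if d: "0 \<le> d" for d
    proof -
      have "q (x + x') - (p (x' + d *\<^sub>R y) - d * p y) \<le> p (x + c *\<^sub>R y) - c * p y"
        if c: "0 \<le> c" for c
      proof -
        \<comment> \<open>The parameters \<open>c\<close> for \<open>x\<close> and \<open>d\<close>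
          for \<open>x'\<close> combine into the competitor \<open>c + d\<close> for
          \<open>x + x'\<close>; the infima over \<open>c\<close> and \<open>d\<close> are then
          taken one after the other.\<close>
        have "q (x + x') \<le> p (x + x' + (c + d) *\<^sub>R y) - (c + d) * p y"
          using c d by (intro le) simp
        also have "x + x' + (c + d) *\<^sub>R y = (x + c *\<^sub>R y) + (x' + d *\<^sub>R y)"
          by (simp add: algebra_simps)
        also have "p \<dots> \<le> p (x + c *\<^sub>R y) + p (x' + d *\<^sub>R y)" by (rule sublinear_add[OF p])
        finally show ?thesis by (simp add: algebra_simps)
      qed
      then have "q (x + x') - (p (x' + d *\<^sub>R y) - d * p y) \<le> q x" by (rule ge)
      then show ?thesis by simp
    qed
    then have "q (x + x') - q x \<le> q x'" by (rule ge)
    then show ?thesis by simp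
  qed
  have scale: "q (c *\<^sub>R x) \<le> c * q x" if c: "0 < c" for c x
  proof -
    have "q (c *\<^sub>R x) / c \<le> p (x + d *\<^sub>R y) - d * p y" if d: "0 \<le> d" for d
    proof -
      have "q (c *\<^sub>R x) \<le> p (c *\<^sub>R x + (c * d) *\<^sub>R y) - (c * d) * p y"
        using c d by (intro le) simp
      also have "c *\<^sub>R x + (c * d) *\<^sub>R y = c *\<^sub>R (x + d *\<^sub>R y)" by (simp add: algebra_simps)
      also have "p \<dots> = c * p (x + d *\<^sub>R y)" using c by (intro sublinear_scaleR[OF p]) simp
      finally show ?thesis using c by (simp add: field_simps)
    qed
    then have "q (c *\<^sub>R x) / c \<le> q x" by (rule ge)
    then show ?thesis using c by (simp add: field_simps)
  qed
  show thesis using add scale le by (intro that[of q]) (auto simp: sublinear_def)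
qed

text \<open>Hahn--Banach, by taking a minimal sublinear functional below \<open>p\<close>: tilting it in any
  direction does not decrease it, which forces additivity.\<close>

lemma sublinear_dominates_linear:
  fixes p :: "'a::real_vector \<Rightarrow> real"
  assumes p: "sublinear p"
  obtains g where "linear g" "\<And>x. g x \<le> p x"
proof -
  define A where "A = {q. sublinear q \<and> q \<le> p}"
  \<comment> \<open>The order is reversed, so that the maximal element from Zorn's lemma is a
    minimal functional.\<close>
  let ?r = "relation_of (\<lambda>q q'. q' \<le> q) A"
  have "\<exists>m\<in>A. \<forall>a\<in>A. a \<le> m \<longrightarrow> a = m"
  proof (rule predicate_Zorn)
    show "partial_order_on A ?r"
      by (rule partial_order_on_relation_ofI) auto
    fix C assume C: "C \<in> Chains ?r"
    then have CA: "C \<subseteq> A" by (auto simp: Chains_def relation_of_def)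
    have chain: "q \<le> q' \<or> q' \<le> q" if "q \<in> C" "q' \<in> C" for q q'
      using C that by (auto simp: Chains_def relation_of_def)
    show "\<exists>u\<in>A. \<forall>a\<in>C. u \<le> a"
    proof (cases "C = {}")
      case True
      then show ?thesis using p by (auto simp: A_def)
    next
      case False
      \<comment> \<open>The lower bound of a nonempty chain is its pointwise infimum, finite because
        each \<open>q\<close> in the chain satisfies
        \<open>- p (- x) \<le> - q (- x) \<le> q x\<close>.\<close>
      define u where "u x = (INF q\<in>C. q x)" for x
      have bdd: "bdd_below ((\<lambda>q. q x) ` C)" for x
      proof (rule bdd_belowI2)
        fix q assume "q \<in> C"
        then have q: "sublinear q" "q (- x) \<le> p (- x)" using CA by (auto simp: A_def le_fun_def)
        show "- p (- x) \<le> q x" using sublinear_minus[OF q(1), of x] q(2) by simp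
      qed
      have le: "u x \<le> q x" if "q \<in> C" for q x
        unfolding u_def by (rule cINF_lower[OF bdd that])
      have ge: "B \<le> u x" if "\<And>q. q \<in> C \<Longrightarrow> B \<le> q x" for B x
        unfolding u_def using False that by (intro cINF_greatest) auto
      have sub: "sublinear q" if "q \<in> C" for q using CA that by (auto simp: A_def)
      have add: "u (x + y) \<le> u x + u y" for x y
      proof -
        have "u (x + y) - u x \<le> q y" if q: "q \<in> C" for q
        proof -
          have "u (x + y) - q y \<le> q' x" if q': "q' \<in> C" for q'
          proof -
            \<comment> \<open>Comparability supplies one member below both \<open>q\<close> and
              \<open>q'\<close>; this is what makes an infimum of sublinear functionals
              subadditive.\<close>
            obtain q'' where q'': "q'' \<in> C" "q'' \<le> q" "q'' \<le> q'"
              using chain[OF q q'] q q' by auto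
            have "u (x + y) \<le> q'' x + q'' y"
              using le[OF q''(1)] sublinear_add[OF sub[OF q''(1)]] order_trans by blast
            also have "\<dots> \<le> q' x + q y" using q'' by (auto simp: le_fun_def intro: add_mono)
            finally show ?thesis by simp
          qed
          then have "u (x + y) - q y \<le> u x" by (rule ge)
          then show ?thesis by simp
        qed
        then have "u (x + y) - u x \<le> u y" by (rule ge)
        then show ?thesis by simp
      qed
      have scale: "u (c *\<^sub>R x) \<le> c * u x" if c: "0 < c" for c x
      proof -
        have "u (c *\<^sub>R x) / c \<le> q x" if q: "q \<in> C" for q
          using le[OF q, of "c *\<^sub>R x"] sublinear_scaleR[OF sub[OF q], of c x] c
          by (simp add: field_simps)
        then have "u (c *\<^sub>R x) / c \<le> u x" by (rule ge)
        then show ?thesis using c by (simp add: field_simps)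
      qed
      have "u \<le> p"
      proof -
        obtain q where "q \<in> C" using False by blast
        then have "q \<le> p" "u \<le> q" using CA le by (auto simp: A_def le_fun_def)
        then show ?thesis by (rule order_trans[rotated])
      qed
      then have "u \<in> A" using add scale by (auto simp: A_def sublinear_def)
      then show ?thesis using le by (auto simp: le_fun_def)
    qed
  qed
  then obtain g where g: "sublinear g" "g \<le> p"
    and min: "\<And>q. sublinear q \<Longrightarrow> q \<le> p \<Longrightarrow> q \<le> g \<Longrightarrow> q = g"
    by (auto simp: A_def)
  have add: "g (x + y) = g x + g y" for x y
  proof (rule antisym)
    show "g (x + y) \<le> g x + g y" by (rule sublinear_add[OF g(1)])
    \<comment> \<open>The case \<open>c = 0\<close> puts the tilted functional below
      \<open>g\<close>, so minimality identifies the two; \<open>c = 1\<close> is then the missing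
      inequality \<open>g x \<le> g (x + y) - g y\<close>.\<close>
    obtain q where q: "sublinear q" "\<And>x c. 0 \<le> c \<Longrightarrow> q x \<le> g (x + c *\<^sub>R y) - c * g y"
      using sublinear_tilt[OF g(1)] by blast
    have "q \<le> g" using q(2)[of 0] by (auto simp: le_fun_def)
    then have "q = g" using min q(1) g(2) order_trans by blast
    then show "g x + g y \<le> g (x + y)" using q(2)[of 1 x] by simp
  qed
  have scale: "g (c *\<^sub>R x) = c * g x" for c x
  proof (cases "0 \<le> c")
    case True
    then show ?thesis by (rule sublinear_scaleR[OF g(1)])
  next
    case False
    have "g (c *\<^sub>R x) + g ((- c) *\<^sub>R x) = 0"
      unfolding add[symmetric] using sublinear_zero[OF g(1)] by (simp flip: scaleR_add_left)
    moreover have "g ((- c) *\<^sub>R x) = (- c) * g x"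
      using False by (intro sublinear_scaleR[OF g(1)]) simp
    ultimately show ?thesis by simp
  qed
  show thesis
  proof (rule that)
    show "linear g" by (rule linearI) (auto simp: add scale)
    show "g x \<le> p x" for x using g(2) by (simp add: le_fun_def)
  qed
qed

text \<open>Tilting the norm towards \<open>v\<close> before applying Hahn--Banach forces
  \<open>g v \<ge> norm v\<close>, so no functional has to be extended from the span of
  \<open>v\<close>.\<close>

lemma real_norming_functional:
  fixes v :: "'a::real_normed_vector"
  obtains g where "linear g" "\<And>x. g x \<le> norm x" "g v = norm v"
proof -
  obtain q where q: "sublinear q" "\<And>x c. 0 \<le> c \<Longrightarrow> q x \<le> norm (x + c *\<^sub>R v) - c * norm v"
    using sublinear_tilt[OF sublinear_norm] by blast
  obtain g where g: "linear g" "\<And>x. g x \<le> q x"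
    using sublinear_dominates_linear[OF q(1)] by blast
  have le: "g x \<le> norm x" for x using g(2)[of x] q(2)[of 0 x] by simp
  have "g (- v) \<le> - norm v" using g(2)[of "- v"] q(2)[of 1 "- v"] by simp
  then have "norm v \<le> g v" by (simp add: linear_neg[OF g(1)])
  then show thesis using that g(1) le by (meson antisym)
qed

section \<open>Complex scalar multiplication and complex norming functionals\<close>

lemma scaleC_one [simp]: "1 *\<^sub>C x = x" for x :: "'a::complex_normed_vector"
  using scaleR_scaleC[of 1 x] by simp

lemma scaleC_zero_left [simp]: "0 *\<^sub>C x = 0" for x :: "'a::complex_normed_vector"
  using scaleR_scaleC[of 0 x] by simp

lemma scaleC_zero_right [simp]: "c *\<^sub>C 0 = (0 :: 'a::complex_normed_vector)"
  using norm_scaleC[of c "0::'a"] by simp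

text \<open>Makes the continuity and product rules for real bounded bilinear maps available for
  complex scalars.\<close>

lemma bounded_bilinear_scaleC:
  "bounded_bilinear (scaleC :: complex \<Rightarrow> 'a \<Rightarrow> 'a::complex_normed_vector)"
proof
  show "(r *\<^sub>R a) *\<^sub>C b = r *\<^sub>R (a *\<^sub>C b)" for r a and b :: 'a
    by (simp add: scaleR_scaleC scaleC_scaleC scaleC_complex_def)
  show "a *\<^sub>C (r *\<^sub>R b) = r *\<^sub>R (a *\<^sub>C b)" for r a and b :: 'a
    by (simp add: scaleR_scaleC scaleC_scaleC mult.commute)
  show "\<exists>K. \<forall>a (b::'a). norm (a *\<^sub>C b) \<le> norm a * norm b * K"
    by (rule exI[of _ 1]) (simp add: norm_scaleC)
qed (simp_all add: scaleC_add_left scaleC_add_right)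

text \<open>The complex functional with real part \<open>g\<close> is \<open>x \<mapsto> g x - i g (i x)\<close>.\<close>

lemma norming_functional:
  fixes v :: "'a::complex_normed_vector"
  obtains l :: "'a \<Rightarrow> complex"
  where "bounded_linear l" "\<And>c x. l (c *\<^sub>C x) = c * l x" "\<And>x. cmod (l x) \<le> norm x"
    "l v = of_real (norm v)"
proof -
  obtain g where g: "linear g" "\<And>x. g x \<le> norm x" "g v = norm v"
    using real_norming_functional by blast
  define l where "l x = Complex (g x) (- g (\<i> *\<^sub>C x))" for x
  have add: "l (x + y) = l x + l y" for x y
    by (simp add: l_def complex_eq_iff scaleC_add_right linear_add[OF g(1)])
  have scaleR: "l (r *\<^sub>R x) = r *\<^sub>R l x" for r x
  proof -
    have "\<i> *\<^sub>C (r *\<^sub>R x) = r *\<^sub>R (\<i> *\<^sub>C x)"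
      by (rule bounded_bilinear.scaleR_right[OF bounded_bilinear_scaleC])
    then show ?thesis by (simp add: l_def complex_eq_iff linear_scale[OF g(1)])
  qed
  have ii: "l (\<i> *\<^sub>C x) = \<i> * l x" for x
  proof -
    have "\<i> *\<^sub>C (\<i> *\<^sub>C x) = - x"
      using scaleR_scaleC[of "-1" x] by (simp add: scaleC_scaleC)
    then show ?thesis by (simp add: l_def complex_eq_iff linear_neg[OF g(1)])
  qed
  have scaleC: "l (c *\<^sub>C x) = c * l x" for c x
  proof -
    have "c = of_real (Re c) + of_real (Im c) * \<i>" by (simp add: complex_eq_iff)
    then have "c *\<^sub>C x = (of_real (Re c) + of_real (Im c) * \<i>) *\<^sub>C x" by simp
    also have "\<dots> = Re c *\<^sub>R x + Im c *\<^sub>R (\<i> *\<^sub>C x)"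
      by (simp only: scaleC_add_left scaleR_scaleC scaleC_scaleC)
    finally have "l (c *\<^sub>C x) = Re c *\<^sub>R l x + Im c *\<^sub>R (\<i> * l x)"
      by (simp only: add scaleR ii)
    also have "\<dots> = c * l x"
      by (simp add: complex_eq_iff)
    finally show ?thesis .
  qed
  have le: "cmod (l x) \<le> norm x" for x
  proof (cases "l x = 0")
    case False
    \<comment> \<open>The unimodular factor that rotates \<open>l x\<close> onto the positive real
      axis, where the modulus is the real part \<open>g\<close>.\<close>
    define c where "c = cnj (l x) / of_real (cmod (l x))"
    have c: "cmod c = 1" using False by (simp add: c_def norm_divide)
    have "l (c *\<^sub>C x) = l x * cnj (l x) / of_real (cmod (l x))" by (simp add: scaleC c_def)
    also have "\<dots> = of_real (cmod (l x))"
      using False by (simp add: power2_eq_square flip: complex_norm_square)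
    finally have "l (c *\<^sub>C x) = of_real (cmod (l x))" .
    then have "cmod (l x) = Re (l (c *\<^sub>C x))" by simp
    also have "\<dots> = g (c *\<^sub>C x)" by (simp add: l_def)
    also have "\<dots> \<le> norm x" using g(2)[of "c *\<^sub>C x"] by (simp add: norm_scaleC c)
    finally show ?thesis .
  qed simp
  have v: "l v = of_real (norm v)"
  proof -
    have re: "Re (l v) = norm v" by (simp add: l_def g(3))
    \<comment> \<open>The real part of \<open>l v\<close> already exhausts the bound
      \<open>norm v\<close> on the modulus, so the imaginary part vanishes.\<close>
    have "(Re (l v))\<^sup>2 + (Im (l v))\<^sup>2 \<le> (norm v)\<^sup>2"
      using le[of v] by (simp add: cmod_def real_le_lsqrt sqrt_le_D)
    then have "(Im (l v))\<^sup>2 \<le> 0" using re by simp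
    then have "Im (l v) = 0" by simp
    then show ?thesis using re by (simp add: complex_eq_iff)
  qed
  have "bounded_linear l"
    by (rule bounded_linear_intro[of _ 1]) (auto simp: add scaleR le)
  then show thesis using that scaleC le v by blast
qed

subsection \<open>Bounded power series in the disc\<close>

text \<open>\<open>K\<close> is the shifted series. For \<open>w \<noteq> 0\<close> it converges
  since it is the given series divided by \<open>w ^ n\<close>; at 0 only its constant term
  remains.\<close>

lemma power_series_factor:
  fixes a :: "nat \<Rightarrow> complex"
  assumes F: "\<And>w. w \<in> ball 0 1 \<Longrightarrow> (\<lambda>j. a j * w ^ j) sums F w" and a: "\<And>j. j < n \<Longrightarrow> a j = 0"
  obtains K where "K holomorphic_on ball 0 1" "K 0 = a n"
    "\<And>w. w \<in> ball 0 1 \<Longrightarrow> F w = w ^ n * K w"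
proof -
  define K where "K w = (\<Sum>j. a (j + n) * w ^ j)" for w
  have K: "(\<lambda>j. a (j + n) * w ^ j) sums K w \<and> F w = w ^ n * K w" if w: "w \<in> ball 0 1" "w \<noteq> 0" for w
  proof -
    have "(\<lambda>j. a (j + n) * w ^ (j + n)) sums F w"
      using F[OF w(1)] a by (simp add: sums_iff_shift[where f = "\<lambda>j. a j * w ^ j"])
    then have "(\<lambda>j. inverse (w ^ n) * (a (j + n) * w ^ (j + n))) sums (inverse (w ^ n) * F w)"
      by (rule sums_mult)
    then have "(\<lambda>j. a (j + n) * w ^ j) sums (inverse (w ^ n) * F w)"
      using w(2) by (simp add: power_add field_simps)
    then show ?thesis using w(2) by (simp add: K_def sums_iff field_simps)
  qed
  have K0: "(\<lambda>j. a (j + n) * 0 ^ j) sums a n" using powser_sums_zero[of "\<lambda>j. a (j + n)"] by simp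
  have sums: "(\<lambda>j. a (j + n) * w ^ j) sums K w" if "w \<in> ball 0 1" for w
    using K[OF that] K0 by (cases "w = 0") (auto simp: K_def sums_iff)
  show thesis
  proof (rule that)
    show "K holomorphic_on ball 0 1"
      using sums by (intro power_series_holomorphic[where a = "\<lambda>j. a (j + n)"]) simp
    show K0': "K 0 = a n" using K0 by (simp add: K_def sums_iff)
    show "F w = w ^ n * K w" if "w \<in> ball 0 1" for w
    proof (cases "w = 0")
      case True
      have "F 0 = a 0" using F[of 0] powser_sums_zero[of a] by (simp add: sums_iff)
      then show ?thesis using True a[of 0] K0' by (cases "n = 0") auto
    next
      case False
      then show ?thesis using K that by blast
    qed
  qed
qed

text \<open>The maximum principle on the circle of radius \<open>r\<close> gives
  \<open>cmod (K w) \<le> 1 / r ^ n\<close>; then \<open>r\<close> tends to 1.\<close>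

lemma Schwarz_power:
  assumes K: "K holomorphic_on ball 0 1" and le: "\<And>w. w \<in> ball 0 1 \<Longrightarrow> cmod (w ^ n * K w) \<le> 1"
    and w: "w \<in> ball 0 1"
  shows "cmod (K w) \<le> 1"
proof -
  have bound: "r ^ n * cmod (K w) \<le> 1" if r: "cmod w < r" "r < 1" for r
  proof -
    have r0: "0 < r" using r norm_ge_zero[of w] by linarith
    have "cmod (K w) \<le> 1 / r ^ n"
    proof (rule maximum_modulus_frontier[where f = K and S = "cball 0 r"])
      show "K holomorphic_on interior (cball 0 r)"
        using K by (rule holomorphic_on_subset) (use r in auto)
      show "continuous_on (closure (cball 0 r)) K"
        using holomorphic_on_imp_continuous_on[OF K] by (rule continuous_on_subset) (use r in auto)
      show "w \<in> cball 0 r" using r by simp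
      show "cmod (K z) \<le> 1 / r ^ n" if "z \<in> frontier (cball 0 r)" for z
        using le[of z] that r r0 by (simp add: norm_mult norm_power field_simps)
    qed simp
    then show ?thesis using r0 by (simp add: field_simps)
  qed
  have lim: "((\<lambda>r. r ^ n * cmod (K w)) \<longlongrightarrow> 1 ^ n * cmod (K w)) (at_left (1::real))"
    by (intro tendsto_intros)
  have "\<forall>\<^sub>F r in at_left (1::real). r ^ n * cmod (K w) \<le> 1"
    using eventually_at_left_real[of "cmod w" 1] w by (auto elim!: eventually_mono intro: bound)
  from tendsto_upperbound[OF lim this] show ?thesis by simp
qed

section \<open>Moebius maps, coefficient and growth estimates\<close>

lemma Moebius_identity:
  "(cmod (1 - cnj a * w))\<^sup>2 - (cmod (w - a))\<^sup>2 = (1 - (cmod a)\<^sup>2) * (1 - (cmod w)\<^sup>2)"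
  by (simp only: cmod_power2) (simp add: algebra_simps power2_eq_square)

lemma Moebius_less:
  assumes "cmod a < 1" "cmod w < 1"
  shows "cmod (w - a) < cmod (1 - cnj a * w)"
proof -
  have "(cmod a)\<^sup>2 < 1" "(cmod w)\<^sup>2 < 1" using assms by (simp_all add: power_less_one_iff)
  then have "0 < (1 - (cmod a)\<^sup>2) * (1 - (cmod w)\<^sup>2)" by simp
  then have "(cmod (w - a))\<^sup>2 < (cmod (1 - cnj a * w))\<^sup>2"
    unfolding Moebius_identity[symmetric] by simp
  then show ?thesis by (rule power_less_imp_less_base) simp
qed

text \<open>The disc automorphism taking \<open>a 0\<close> to 0, applied after \<open>F\<close>,
  yields a function bounded by 1 with a zero of order at least \<open>n\<close>. Dividing by
  \<open>w ^ n\<close> gives \<open>h\<close>, and \<open>Schwarz_power\<close> bounds it.\<close>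

lemma Moebius_series_factor:
  fixes a :: "nat \<Rightarrow> complex"
  assumes F: "\<And>w. w \<in> ball 0 1 \<Longrightarrow> (\<lambda>j. a j * w ^ j) sums F w"
    and lt: "\<And>w. w \<in> ball 0 1 \<Longrightarrow> cmod (F w) < 1"
    and a: "\<And>j. 0 < j \<Longrightarrow> j < n \<Longrightarrow> a j = 0" and n: "0 < n"
  obtains h where "\<And>w. w \<in> ball 0 1 \<Longrightarrow> F w - a 0 = w ^ n * h w * (1 - cnj (a 0) * F w)"
    "h 0 * (1 - (cmod (a 0))\<^sup>2) = a n" "\<And>w. w \<in> ball 0 1 \<Longrightarrow> cmod (h w) \<le> 1"
proof -
  have F0: "F 0 = a 0" using F[of 0] powser_sums_zero[of a] by (simp add: sums_iff)
  have a0: "cmod (a 0) < 1" using lt[of 0] F0 by simp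
  \<comment> \<open>Deleting the constant coefficient makes the first \<open>n\<close> coefficients
    vanish, as \<open>power_series_factor\<close> requires.\<close>
  have "(\<lambda>j. (a(0 := 0)) j * w ^ j) sums (F w - a 0)" if "w \<in> ball 0 1" for w
  proof -
    have "(\<lambda>j. a (Suc j) * w ^ Suc j) sums (F w - a 0)"
      using F[OF that] by (subst sums_Suc_iff[where f = "\<lambda>j. a j * w ^ j"]) simp
    then have "(\<lambda>j. (a(0 := 0)) (Suc j) * w ^ Suc j) sums (F w - a 0)" by simp
    then show ?thesis by (subst (asm) sums_Suc_iff) simp
  qed
  then obtain K where K: "K holomorphic_on ball 0 1" "K 0 = (a(0 := 0)) n"
      "\<And>w. w \<in> ball 0 1 \<Longrightarrow> F w - a 0 = w ^ n * K w"
    by (rule power_series_factor[of "a(0 := 0)" "\<lambda>w. F w - a 0" n]) (use a in auto)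
  have hol: "F holomorphic_on ball 0 1"
    using F by (intro power_series_holomorphic[where a = a]) simp
  have ne: "1 - cnj (a 0) * F w \<noteq> 0" if "w \<in> ball 0 1" for w
    using Moebius_less[OF a0 lt[OF that]] norm_ge_zero[of "F w - a 0"] by auto
  define h where "h w = K w / (1 - cnj (a 0) * F w)" for w
  have eq: "F w - a 0 = w ^ n * h w * (1 - cnj (a 0) * F w)" if "w \<in> ball 0 1" for w
    using K(3)[OF that] ne[OF that] by (simp add: h_def)
  show thesis
  proof (rule that[OF eq])
    have "1 - cnj (a 0) * F 0 = 1 - (cmod (a 0))\<^sup>2"
      using complex_norm_square[of "a 0"] by (simp add: F0 mult.commute)
    then show "h 0 * (1 - (cmod (a 0))\<^sup>2) = a n" using K(2) n ne[of 0] by (simp add: h_def)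
    have "h holomorphic_on ball 0 1"
      unfolding h_def using K(1) hol ne by (intro holomorphic_intros) auto
    then show "cmod (h w) \<le> 1" if "w \<in> ball 0 1" for w
    proof (rule Schwarz_power[of _ n])
      fix w :: complex assume w: "w \<in> ball 0 1"
      have "cmod (F w - a 0) = cmod (w ^ n * h w) * cmod (1 - cnj (a 0) * F w)"
        by (subst eq[OF w]) (simp add: norm_mult)
      moreover have "cmod (F w - a 0) < cmod (1 - cnj (a 0) * F w)" by (rule Moebius_less[OF a0 lt[OF w]])
      ultimately show "cmod (w ^ n * h w) \<le> 1" using ne[OF w]
        by (smt (verit) mult_le_cancel_right1 norm_ge_zero)
    qed (rule that)
  qed
qed

text \<open>The terms are the powers of \<open>z = cis (2 * pi / n) ^ j\<close>, an
  \<open>n\<close>-th root of unity that equals 1 exactly when \<open>n\<close> divides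
  \<open>j\<close>; otherwise the geometric sum is 0.\<close>

lemma sum_roots_of_unity_power:
  fixes n j :: nat
  assumes n: "0 < n"
  shows "(\<Sum>i<n. cis (2 * pi / n) ^ (i * j)) = (if n dvd j then of_nat n else 0)"
proof -
  define z where "z = cis (2 * pi / n) ^ j"
  have zn: "z ^ n = 1"
  proof -
    have "z ^ n = (cis (2 * pi / n) ^ n) ^ j" by (simp add: z_def mult.commute flip: power_mult)
    also have "cis (2 * pi / n) ^ n = 1" unfolding Complex.DeMoivre using n by simp
    finally show ?thesis by simp
  qed
  have eq: "(\<Sum>i<n. cis (2 * pi / n) ^ (i * j)) = (\<Sum>i<n. z ^ i)"
    by (simp add: z_def mult.commute flip: power_mult)
  show ?thesis
  proof (cases "n dvd j")
    case True
    then obtain q where "j = n * q" by blast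
    then have "z = 1" using n by (simp add: z_def Complex.DeMoivre power_mult)
    then show ?thesis using True eq by simp
  next
    case False
    have "z \<noteq> 1"
    proof
      assume "z = 1"
      then have "cis (real j * (2 * pi / n)) = 1" by (simp add: z_def Complex.DeMoivre)
      then have "cos (real j * (2 * pi / n)) = 1" by (simp add: complex_eq_iff)
      then obtain q :: int where "real j * (2 * pi / n) = of_int q * 2 * pi"
        using cos_one_2pi_int by blast
      then have "real j = of_int q * real n" using n by (simp add: field_simps)
      then have "int j = q * int n" by (metis of_int_eq_iff of_int_mult of_int_of_nat_eq)
      then show False using False by (metis dvd_triv_right int_dvd_int_iff)
    qed
    then have "(\<Sum>i<n. z ^ i) = 0" using zn by (simp add: geometric_sum)
    then show ?thesis using False eq by simp
  qed
qed

text \<open>Averaging over the rotations by \<open>n\<close>-th roots of unity removes the coefficients between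
  \<open>0\<close> and \<open>n\<close>.\<close>

lemma bounded_power_series_coeff_le:
  fixes a :: "nat \<Rightarrow> complex"
  assumes F: "\<And>w. w \<in> ball 0 1 \<Longrightarrow> (\<lambda>j. a j * w ^ j) sums F w"
    and lt: "\<And>w. w \<in> ball 0 1 \<Longrightarrow> cmod (F w) < 1" and n: "0 < n"
  shows "cmod (a n) \<le> 1 - (cmod (a 0))\<^sup>2"
proof -
  define u where "u = cis (2 * pi / n)"
  have u: "u ^ i * w \<in> ball 0 1" if "w \<in> ball 0 1" for i w
    using that by (simp add: u_def norm_mult norm_power)
  \<comment> \<open>\<open>b\<close> are the coefficients of the average \<open>G\<close>, which
    again maps the disc into itself. Both \<open>a 0\<close> and \<open>a n\<close> survive, since
    \<open>n\<close> divides 0 and \<open>n\<close>.\<close>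
  define b where "b j = (if n dvd j then a j else 0)" for j
  define G where "G w = (\<Sum>i<n. F (u ^ i * w)) / of_nat n" for w
  have G: "(\<lambda>j. b j * w ^ j) sums G w" if w: "w \<in> ball 0 1" for w
  proof -
    have "(\<lambda>j. (\<Sum>i<n. a j * (u ^ i * w) ^ j) / of_nat n) sums G w"
      unfolding G_def by (intro sums_divide sums_sum F u w)
    moreover have "(\<Sum>i<n. a j * (u ^ i * w) ^ j) / of_nat n = b j * w ^ j" for j
    proof -
      have "(\<Sum>i<n. a j * (u ^ i * w) ^ j) = a j * w ^ j * (\<Sum>i<n. u ^ (i * j))"
        by (simp add: sum_distrib_left power_mult_distrib power_mult mult_ac)
      then show ?thesis using sum_roots_of_unity_power[OF n, of j] n by (simp add: u_def b_def)
    qed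
    ultimately show ?thesis by simp
  qed
  have Glt: "cmod (G w) < 1" if w: "w \<in> ball 0 1" for w
  proof -
    have "cmod (\<Sum>i<n. F (u ^ i * w)) \<le> (\<Sum>i<n. cmod (F (u ^ i * w)))" by (rule norm_sum)
    also have "\<dots> < (\<Sum>i<n. 1)" using n lt u w by (intro sum_strict_mono) auto
    finally show ?thesis using n by (simp add: G_def norm_divide)
  qed
  have b: "b j = 0" if "0 < j" "j < n" for j using that by (auto simp: b_def dest: dvd_imp_le)
  obtain h where "\<And>w. w \<in> ball 0 1 \<Longrightarrow> G w - b 0 = w ^ n * h w * (1 - cnj (b 0) * G w)"
    and h: "h 0 * (1 - (cmod (b 0))\<^sup>2) = b n" "\<And>w. w \<in> ball 0 1 \<Longrightarrow> cmod (h w) \<le> 1"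
    by (rule Moebius_series_factor[of b G n]) (use G Glt b n in \<open>auto intro: that\<close>)
  have a0: "cmod (a 0) < 1" using Glt[of 0] G[of 0] powser_sums_zero[of b] by (simp add: sums_iff b_def)
  have *: "0 \<le> 1 - (cmod (a 0))\<^sup>2" using a0 by (simp add: power_le_one_iff)
  have "cmod (a n) = cmod (h 0 * of_real (1 - (cmod (a 0))\<^sup>2))" using h(1) by (simp add: b_def)
  also have "\<dots> = cmod (h 0) * (1 - (cmod (a 0))\<^sup>2)" unfolding norm_mult norm_of_real using * by simp
  also have "\<dots> \<le> 1 - (cmod (a 0))\<^sup>2" using h(2)[of 0] * by (simp add: mult_left_le_one_le)
  finally show ?thesis .
qed

text \<open>The factorization with \<open>n = 1\<close> reads \<open>F w = a 0 + g * B\<close> with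
  \<open>cmod g \<le> cmod w\<close>. The Moebius identity expresses
  \<open>1 - (cmod (F w))\<^sup>2\<close> through \<open>B\<close> and \<open>g\<close>, so a lower
  bound for \<open>cmod B\<close> suffices.\<close>

lemma bounded_power_series_growth:
  fixes a :: "nat \<Rightarrow> complex"
  assumes F: "\<And>w. w \<in> ball 0 1 \<Longrightarrow> (\<lambda>j. a j * w ^ j) sums F w"
    and lt: "\<And>w. w \<in> ball 0 1 \<Longrightarrow> cmod (F w) < 1" and w: "w \<in> ball 0 1"
  shows "(1 - (cmod (a 0))\<^sup>2) * ((1 - cmod w) / (1 + cmod w)) \<le> 1 - (cmod (F w))\<^sup>2"
proof -
  define A where "A = 1 - (cmod (a 0))\<^sup>2"
  obtain h where eq: "F w - a 0 = w ^ 1 * h w * (1 - cnj (a 0) * F w)" and h: "cmod (h w) \<le> 1"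
    by (rule Moebius_series_factor[OF F lt, of 1]) (use w in auto)
  have F0: "F 0 = a 0" using F[of 0] powser_sums_zero[of a] by (simp add: sums_iff)
  have a0: "cmod (a 0) < 1" using lt[of 0] F0 by simp
  then have A: "0 < A" by (simp add: A_def power_less_one_iff)
  define B where "B = 1 - cnj (a 0) * F w"
  define g where "g = w * h w"
  have g: "cmod g \<le> cmod w" using mult_left_mono[OF h, of "cmod w"] by (simp add: g_def norm_mult)
  have r: "cmod w < 1" using w by simp
  have aa: "a 0 * cnj (a 0) = of_real ((cmod (a 0))\<^sup>2)" by (simp only: complex_norm_square)
  have FB: "F w = a 0 + g * B" using eq by (simp add: g_def B_def algebra_simps)
  \<comment> \<open>Eliminating \<open>F w\<close> determines \<open>B\<close> as
    \<open>A / (1 + cnj (a 0) * g)\<close>, whose denominator is at most \<open>1 + cmod w\<close>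
    in modulus.\<close>
  have "B * (1 + cnj (a 0) * g) = 1 - cnj (a 0) * (F w - g * B)"
    by (simp add: B_def algebra_simps)
  also have "\<dots> = of_real A" using aa by (simp add: FB A_def mult.commute)
  finally have "B * (1 + cnj (a 0) * g) = of_real A" .
  then have BA: "cmod B * cmod (1 + cnj (a 0) * g) = A"
    using A by (metis abs_of_pos norm_mult norm_of_real)
  have "cmod (1 + cnj (a 0) * g) \<le> 1 + cmod (a 0) * cmod g"
    by (rule order_trans[OF norm_triangle_ineq]) (simp add: norm_mult)
  also have "\<dots> \<le> 1 + cmod w" using g a0 mult_mono[of "cmod (a 0)" 1 "cmod g" "cmod w"] by simp
  finally have "A \<le> cmod B * (1 + cmod w)" unfolding BA[symmetric] by (intro mult_left_mono) auto
  then have Bge: "A / (1 + cmod w) \<le> cmod B"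
    by (simp add: pos_divide_le_eq add_pos_nonneg)
  have "F w - a 0 = g * B" using FB by simp
  then have "(cmod B)\<^sup>2 - (cmod (g * B))\<^sup>2 = A * (1 - (cmod (F w))\<^sup>2)"
    unfolding A_def B_def Moebius_identity[symmetric] by simp
  then have main: "A * (1 - (cmod (F w))\<^sup>2) = (cmod B)\<^sup>2 * (1 - (cmod g)\<^sup>2)"
    by (simp add: norm_mult power_mult_distrib algebra_simps)
  have "(A / (1 + cmod w))\<^sup>2 * (1 - (cmod w)\<^sup>2) \<le> (cmod B)\<^sup>2 * (1 - (cmod g)\<^sup>2)"
    using Bge g r A by (intro mult_mono power_mono diff_mono) (auto simp: power_le_one_iff)
  also have "\<dots> = A * (1 - (cmod (F w))\<^sup>2)" by (rule main[symmetric])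
  finally have "(A / (1 + cmod w))\<^sup>2 * (1 - (cmod w)\<^sup>2) / A \<le> 1 - (cmod (F w))\<^sup>2"
    using A by (simp only: pos_divide_le_eq mult.commute)
  moreover have "(A / (1 + cmod w))\<^sup>2 * (1 - (cmod w)\<^sup>2) / A = A * ((1 - cmod w) / (1 + cmod w))"
  proof -
    have ne: "1 + cmod w \<noteq> 0" using norm_ge_zero[of w] by linarith
    have "1 - (cmod w)\<^sup>2 = (1 - cmod w) * (1 + cmod w)" by (simp add: power2_eq_square algebra_simps)
    then show ?thesis using A ne by (simp add: power2_eq_square)
  qed
  ultimately show ?thesis by (simp add: A_def)
qed

subsection \<open>The upper bound\<close>

lemma homogeneous_polynomial_scaleC:
  assumes "homogeneous_polynomial j P"
  shows "P (c *\<^sub>C x) = c ^ j *\<^sub>C P x"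
proof -
  obtain u where u: "continuous_multilinear j u" "\<And>x. P x = u (\<lambda>i\<in>{..<j}. x)"
    using assms by (auto simp: homogeneous_polynomial_def)
  \<comment> \<open>The \<open>j\<close> equal arguments are scaled one slot at a time;
    \<open>g n\<close> has the first \<open>n\<close> slots scaled.\<close>
  define g where "g n = (\<lambda>i\<in>{..<j}. if i < n then c *\<^sub>C x else x)" for n
  have "u (g n) = c ^ n *\<^sub>C u (g 0)" if "n \<le> j" for n
    using that
  proof (induction n)
    case (Suc n)
    have g: "g n \<in> {..<j} \<rightarrow>\<^sub>E UNIV" by (simp add: g_def)
    have "g (Suc n) = (g n)(n := c *\<^sub>C x)" "(g n)(n := x) = g n"
      using Suc.prems by (auto simp: g_def fun_eq_iff)
    then have "u (g (Suc n)) = c *\<^sub>C u (g n)"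
      using u(1) g Suc.prems unfolding continuous_multilinear_def by (metis Suc_le_lessD)
    then show ?case using Suc by (simp add: scaleC_scaleC)
  qed simp
  from this[of j] show ?thesis by (simp add: u(2) g_def cong: restrict_cong)
qed

lemma homogeneous_expansion_slice:
  assumes "homogeneous_expansion f P" "norm u \<le> 1" "cmod w < 1"
  shows "(\<lambda>j. w ^ j *\<^sub>C P j u) sums f (w *\<^sub>C u)"
proof -
  have "norm (w *\<^sub>C u) < 1"
    using mult_left_mono[OF assms(2), of "cmod w"] assms(3) by (simp add: norm_scaleC)
  then show ?thesis
    using assms(1) by (simp add: homogeneous_expansion_def flip: homogeneous_polynomial_scaleC)
qed

text \<open>The bound \<open>norm u \<le> 1\<close> instead of equality covers \<open>y = 0\<close>,
  where \<open>inverse 0 = 0\<close> makes \<open>u\<close> zero.\<close>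

lemma unit_direction:
  fixes y :: "'a::complex_normed_vector"
  obtains u where "norm u \<le> 1" "y = of_real (norm y) *\<^sub>C u"
proof
  show "norm (inverse (norm y) *\<^sub>R y) \<le> 1" by (cases "y = 0") auto
  show "y = of_real (norm y) *\<^sub>C (inverse (norm y) *\<^sub>R y)"
    by (cases "y = 0") (auto simp flip: scaleR_scaleC)
qed

text \<open>A norming functional of \<open>\<mu> z\<close>, composed with \<open>\<mu>\<close> on
  the line through \<open>z\<close>, gives a scalar power series bounded by 1 whose first
  \<open>n\<close> coefficients vanish; at the parameter \<open>norm z\<close> its modulus is
  \<open>norm (\<mu> z)\<close>.\<close>

lemma Schwarz_zero_of_order:
  fixes \<mu> :: "'a::complex_normed_vector \<Rightarrow> 'a"
  assumes \<mu>: "schwarz_mapping \<mu>" "zero_of_order \<mu> n" and z: "norm z < 1"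
  shows "norm (\<mu> z) \<le> norm z ^ n"
proof -
  obtain Q where Q: "homogeneous_expansion \<mu> Q" "\<And>j x. j < n \<Longrightarrow> Q j x = 0"
    using \<mu>(2) by (auto simp: zero_of_order_def)
  obtain u where u: "norm u \<le> 1" "z = of_real (norm z) *\<^sub>C u" by (rule unit_direction)
  obtain l :: "'a \<Rightarrow> complex" where l: "bounded_linear l" "\<And>c x. l (c *\<^sub>C x) = c * l x"
      "\<And>x. cmod (l x) \<le> norm x" "l (\<mu> z) = of_real (norm (\<mu> z))"
    by (rule norming_functional[of "\<mu> z"]) (rule that; assumption)
  define F where "F w = l (\<mu> (w *\<^sub>C u))" for w
  have F: "(\<lambda>j. l (Q j u) * w ^ j) sums F w" if "w \<in> ball 0 1" for w
    using bounded_linear.sums[OF l(1) homogeneous_expansion_slice[OF Q(1) u(1), of w]] that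
    by (simp add: F_def l(2) mult.commute)
  have le: "cmod (F w) \<le> 1" if "w \<in> ball 0 1" for w
  proof -
    have "norm (w *\<^sub>C u) < 1"
      using mult_left_mono[OF u(1), of "cmod w"] that by (simp add: norm_scaleC)
    then have "norm (\<mu> (w *\<^sub>C u)) < 1"
      using \<mu>(1) unfolding schwarz_mapping_def by (metis image_subset_iff mem_ball_0)
    then show ?thesis using l(3)[of "\<mu> (w *\<^sub>C u)"] by (simp add: F_def)
  qed
  have Q0: "l (Q j u) = 0" if "j < n" for j
    using Q(2)[OF that] l(1) by (simp add: linear_0 bounded_linear.linear)
  obtain K where K: "K holomorphic_on ball 0 1" "K 0 = l (Q n u)"
      "\<And>w. w \<in> ball 0 1 \<Longrightarrow> F w = w ^ n * K w"
    by (rule power_series_factor[of "\<lambda>j. l (Q j u)" F n]) (use F Q0 in \<open>auto intro: that\<close>)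
  define w :: complex where "w = of_real (norm z)"
  have w: "w \<in> ball 0 1" using z by (simp add: w_def)
  have "cmod (w ^ n * K w) \<le> 1" if "w \<in> ball 0 1" for w
    using le[OF that] K(3)[OF that] by simp
  then have K1: "cmod (K w) \<le> 1" by (rule Schwarz_power[OF K(1) _ w])
  have nw: "cmod w = norm z" by (simp add: w_def)
  have "norm (\<mu> z) = cmod (F w)" using u(2) l(4) by (simp add: F_def w_def)
  also have "\<dots> = norm z ^ n * cmod (K w)" by (simp add: K(3)[OF w] norm_mult norm_power nw)
  also have "\<dots> \<le> norm z ^ n" using mult_left_mono[OF K1, of "norm z ^ n"] by simp
  finally show ?thesis .
qed

section \<open>Estimates for \<open>f\<close> on the ball by slicing along complex lines\<close>

context
  fixes f :: "'a::complex_normed_vector \<Rightarrow> complex" and P :: "nat \<Rightarrow> 'a \<Rightarrow> complex"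
  assumes P: "homogeneous_expansion f P" and f: "f ` ball 0 1 \<subseteq> ball 0 1"
begin

lemma slice_sums:
  assumes "norm u \<le> 1" "w \<in> ball 0 1"
  shows "(\<lambda>j. P j u * w ^ j) sums f (w *\<^sub>C u)"
  using homogeneous_expansion_slice[OF P assms(1), of w] assms(2)
  by (simp add: scaleC_complex_def mult.commute)

lemma slice_less:
  assumes "norm u \<le> 1" "w \<in> ball 0 1"
  shows "cmod (f (w *\<^sub>C u)) < 1"
proof -
  have "norm (w *\<^sub>C u) < 1"
    using mult_left_mono[OF assms(1), of "cmod w"] assms(2) by (simp add: norm_scaleC)
  then have "w *\<^sub>C u \<in> ball 0 1" by simp
  then show ?thesis using f by (metis image_subset_iff mem_ball_0)
qed

lemma slice_zero:
  assumes "norm u \<le> 1"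
  shows "P 0 u = f 0"
  using slice_sums[OF assms, of 0] powser_sums_zero[of "\<lambda>j. P j u"] by (simp add: sums_iff)

lemma homogeneous_coeff_le:
  assumes "0 < n"
  shows "cmod (P n y) \<le> (1 - (cmod (f 0))\<^sup>2) * norm y ^ n"
proof -
  obtain u where u: "norm u \<le> 1" "y = of_real (norm y) *\<^sub>C u" by (rule unit_direction)
  have "homogeneous_polynomial n (P n)" using P by (simp add: homogeneous_expansion_def)
  then have "P n (of_real (norm y) *\<^sub>C u) = of_real (norm y) ^ n *\<^sub>C P n u"
    by (rule homogeneous_polynomial_scaleC)
  then have "cmod (P n y) = norm y ^ n * cmod (P n u)"
    using u(2) by (simp add: norm_scaleC norm_power)
  moreover have "cmod (P n u) \<le> 1 - (cmod (f 0))\<^sup>2"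
    using bounded_power_series_coeff_le[OF slice_sums[OF u(1)] slice_less[OF u(1)] assms]
    by (simp add: slice_zero[OF u(1)])
  ultimately show ?thesis by (simp add: mult.commute mult_left_mono)
qed

lemma homogeneous_growth:
  assumes "norm y < 1"
  shows "(1 - (cmod (f 0))\<^sup>2) * ((1 - norm y) / (1 + norm y)) \<le> 1 - (cmod (f y))\<^sup>2"
proof -
  obtain u where u: "norm u \<le> 1" "y = of_real (norm y) *\<^sub>C u" by (rule unit_direction)
  show ?thesis
    using bounded_power_series_growth[OF slice_sums[OF u(1)] slice_less[OF u(1)], of "of_real (norm y)"] assms
    by (simp add: slice_zero[OF u(1)] flip: u(2))
qed

end

section \<open>Real inequalities and the root of \<open>Psi2\<close>\<close>

lemma powr_Bernoulli:
  fixes x p :: real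
  assumes "0 \<le> x" "0 < p" "p \<le> 2"
  shows "x powr p \<le> 1 - p / 2 * (1 - x\<^sup>2)"
proof (cases "x = 0")
  case False
  then have x: "0 < x" using assms by simp
  \<comment> \<open>Weighted arithmetic-geometric mean inequality for \<open>x\<^sup>2\<close> and 1
    with weights \<open>p / 2\<close> and \<open>1 - p / 2\<close>; the second is nonnegative
    because \<open>p \<le> 2\<close>.\<close>
  have "x powr p = (x\<^sup>2) powr (p / 2) * 1 powr (1 - p / 2)"
    using x by (simp add: powr_powr flip: powr_numeral)
  also have "\<dots> \<le> p / 2 * x\<^sup>2 + (1 - p / 2) * 1"
    using assms x by (intro Youngs_inequality_0) auto
  finally show ?thesis by (simp add: algebra_simps)
qed (use assms in simp)

lemma ratio_decreasing:
  fixes x y :: real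
  assumes "0 \<le> x" "x \<le> y"
  shows "(1 - y) / (1 + y) \<le> (1 - x) / (1 + x)"
  using assms by (simp add: divide_simps algebra_simps)

text \<open>The first term does not decrease and the subtracted one strictly decreases. This makes
  the root unique and fixes the sign of \<open>Psi2\<close> on either side of it.\<close>

lemma Psi2_strict_mono:
  assumes "0 \<le> x" "x < y" "y < 1" "0 < k" "0 < m" "0 < s" "0 < p" "0 < lam"
  shows "Psi2 p m k lam s t x < Psi2 p m k lam s t y"
proof -
  have "x ^ (k * (s + t)) / (1 - x ^ (k * s)) \<le> y ^ (k * (s + t)) / (1 - y ^ (k * s))"
    using assms by (intro frac_le diff_left_mono power_mono) (auto simp: power_less_one_iff)
  then have "2 * lam * (x ^ (k * (s + t)) / (1 - x ^ (k * s)))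
      \<le> 2 * lam * (y ^ (k * (s + t)) / (1 - y ^ (k * s)))"
    using assms by (intro mult_left_mono) auto
  moreover have "x ^ m < y ^ m" using assms by (intro power_strict_mono) auto
  then have "(1 - y ^ m) / (1 + y ^ m) < (1 - x ^ m) / (1 + x ^ m)"
    using assms by (intro frac_less) (auto simp: power_le_one add_pos_nonneg)
  then have "p * ((1 - y ^ m) / (1 + y ^ m)) < p * ((1 - x ^ m) / (1 + x ^ m))"
    using assms(7) by (rule mult_strict_left_mono)
  ultimately show ?thesis by (simp add: Psi2_def)
qed

lemma Psi2_root:
  assumes "0 < k" "0 < m" "0 < s" "0 < p" "0 < lam"
  shows "\<exists>!r. 0 < r \<and> r < 1 \<and> Psi2 p m k lam s t r = 0"
proof -
  \<comment> \<open>\<open>Psi2\<close> cleared of denominators, hence continuous up to 1;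
    \<open>G 0 = - p\<close> and \<open>G 1 = 4 * lam\<close>.\<close>
  define G where "G r = 2 * lam * r ^ (k * (s + t)) * (1 + r ^ m) - p * (1 - r ^ m) * (1 - r ^ (k * s))"
    for r :: real
  have "continuous_on {0..1} G" unfolding G_def by (intro continuous_intros)
  moreover have G0: "G 0 < 0" and G1: "0 < G 1"
    using assms by (auto simp: G_def zero_power)
  ultimately obtain r where r: "0 \<le> r" "r \<le> 1" "G r = 0"
    using IVT'[of G 0 0 1] by auto
  then have r': "0 < r" "r < 1" using G0 G1 by (auto simp: less_le)
  then have "r ^ (k * s) < 1" "0 < 1 + r ^ m"
    using assms by (auto simp: power_less_one_iff add_pos_pos)
  then have "Psi2 p m k lam s t r = 0"
    using r(3) by (simp add: Psi2_def G_def field_simps)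
  moreover have "x = y" if "0 < x \<and> x < 1 \<and> Psi2 p m k lam s t x = 0"
    "0 < y \<and> y < 1 \<and> Psi2 p m k lam s t y = 0" for x y
    using that Psi2_strict_mono[of x y k m s p lam t] Psi2_strict_mono[of y x k m s p lam t] assms
    by (cases x y rule: linorder_cases) auto
  ultimately show ?thesis using r' by blast
qed

text \<open>Both the series and the deficit \<open>1 - x\<^sup>2\<close> are estimated by multiples
  of the same \<open>A\<close>; comparing the multipliers is exactly
  \<open>Psi2 \<le> 0\<close>.\<close>

lemma Bohr_bound:
  fixes f :: "'a::complex_banach \<Rightarrow> complex" and z :: 'a
  assumes adm: "admissible f P \<mu>" and k: "0 < k" and m: "0 < m" and s: "0 < s"
    and p: "0 < p" "p \<le> 2" and lam: "0 < lam"
    and z: "norm z < 1" and Psi: "Psi2 p m k lam s t (norm z) \<le> 0"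
  shows "summable (H_summand k s t P \<mu> z)" "H p m k lam s t f P \<mu> z \<le> 1"
proof -
  define r where "r = norm z"
  have r: "0 \<le> r" "r < 1" using z by (auto simp: r_def)
  define A where "A = 1 - (cmod (f 0))\<^sup>2"
  have P: "homogeneous_expansion f P" and f: "f ` ball 0 1 \<subseteq> ball 0 1"
    and \<mu>: "\<And>n. 0 < n \<Longrightarrow> schwarz_mapping (\<mu> n) \<and> zero_of_order (\<mu> n) n"
    using adm by (auto simp: admissible_def)
  have \<mu>_le: "norm (\<mu> n z) \<le> r ^ n" if "0 < n" for n
    unfolding r_def using \<mu>[OF that] z by (intro Schwarz_zero_of_order) auto
  have f1: "cmod (f x) < 1" if "norm x < 1" for x
    using f that by (metis image_subset_iff mem_ball_0)
  have A: "0 \<le> A" using f1[of 0] by (simp add: A_def power_le_one)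
  \<comment> \<open>The ratio of the majorant: raising \<open>j\<close> by one raises the exponent
    \<open>k * (s * Suc j + t)\<close> by \<open>k * s\<close>.\<close>
  define q where "q = r ^ (k * s)"
  have q: "0 \<le> q" "q < 1" using r k s by (auto simp: q_def power_less_one_iff)
  have "(\<lambda>j. A * r ^ (k * (s + t)) * q ^ j) sums (A * r ^ (k * (s + t)) * (1 / (1 - q)))"
    using q by (intro sums_mult geometric_sums) simp
  moreover have "r ^ (k * (s * Suc j + t)) = r ^ (k * (s + t)) * q ^ j" for j
    by (simp add: q_def algebra_simps flip: power_add power_mult)
  ultimately have G: "(\<lambda>j. A * r ^ (k * (s * Suc j + t))) sums (A * (r ^ (k * (s + t)) / (1 - q)))"
    by (simp add: mult_ac)
  have le: "H_summand k s t P \<mu> z j \<le> A * r ^ (k * (s * Suc j + t))" for j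
  proof -
    have "H_summand k s t P \<mu> z j \<le> A * norm (\<mu> k z) ^ (s * Suc j + t)"
      unfolding H_summand_def A_def using s by (intro homogeneous_coeff_le[OF P f]) simp
    also have "\<dots> \<le> A * (r ^ k) ^ (s * Suc j + t)"
      using \<mu>_le[OF k] A by (intro mult_left_mono power_mono) auto
    finally show ?thesis by (simp flip: power_mult)
  qed
  show sm: "summable (H_summand k s t P \<mu> z)"
  proof (rule summable_comparison_test'[OF sums_summable[OF G]])
    fix j
    have "norm (H_summand k s t P \<mu> z j) = H_summand k s t P \<mu> z j" by (simp add: H_summand_def)
    then show "norm (H_summand k s t P \<mu> z j) \<le> A * r ^ (k * (s * Suc j + t))"
      using le[of j] by (simp only:)
  qed
  define x where "x = cmod (f (\<mu> m z))"
  define S where "S = (\<Sum>j. H_summand k s t P \<mu> z j)"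
  have S: "S \<le> A * (r ^ (k * (s + t)) / (1 - q))"
    unfolding S_def sums_unique[OF G] by (rule suminf_le[OF le sm sums_summable[OF G]])
  have rm: "r ^ m < 1" using r m by (simp add: power_less_one_iff)
  \<comment> \<open>The growth estimate at \<open>\<mu> m z\<close> is weakened to the radius
    \<open>r ^ m\<close>, since \<open>(1 - x) / (1 + x)\<close> decreases.\<close>
  have "A * ((1 - r ^ m) / (1 + r ^ m)) \<le> A * ((1 - norm (\<mu> m z)) / (1 + norm (\<mu> m z)))"
    using \<mu>_le[OF m] A by (intro mult_left_mono ratio_decreasing) auto
  also have "\<dots> \<le> 1 - x\<^sup>2"
    unfolding A_def x_def using \<mu>_le[OF m] rm by (intro homogeneous_growth[OF P f]) simp
  finally have x: "p / 2 * (A * ((1 - r ^ m) / (1 + r ^ m))) \<le> p / 2 * (1 - x\<^sup>2)"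
    using p by (intro mult_left_mono) auto
  have "lam * S \<le> lam * (A * (r ^ (k * (s + t)) / (1 - q)))"
    using S lam by (intro mult_left_mono) auto
  also have "\<dots> = A * (lam * (r ^ (k * (s + t)) / (1 - q)))" by simp
  also have "\<dots> \<le> A * (p / 2 * ((1 - r ^ m) / (1 + r ^ m)))"
  proof (rule mult_left_mono[OF _ A])
    show "lam * (r ^ (k * (s + t)) / (1 - q)) \<le> p / 2 * ((1 - r ^ m) / (1 + r ^ m))"
      using Psi[unfolded Psi2_def, folded r_def, folded q_def] by linarith
  qed
  also have "\<dots> = p / 2 * (A * ((1 - r ^ m) / (1 + r ^ m)))" by (simp only: mult.left_commute)
  also note x
  finally have "lam * S \<le> p / 2 * (1 - x\<^sup>2)" .
  moreover have "x powr p \<le> 1 - p / 2 * (1 - x\<^sup>2)" using p by (intro powr_Bernoulli) (auto simp: x_def)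
  ultimately show "H p m k lam s t f P \<mu> z \<le> 1" by (simp add: H_def x_def S_def)
qed

subsection \<open>Sharpness\<close>

lemma prod_fun_upd:
  fixes l :: "'a \<Rightarrow> 'b::comm_monoid_mult" and i j :: nat
  assumes "i < j"
  shows "(\<Prod>i'<j. l ((x(i := a)) i')) = l a * (\<Prod>i'\<in>{..<j} - {i}. l (x i'))"
proof -
  have "(\<Prod>i'<j. l ((x(i := a)) i')) = l a * (\<Prod>i'\<in>{..<j} - {i}. l ((x(i := a)) i'))"
    using assms by (subst prod.remove[of _ i]) auto
  also have "(\<Prod>i'\<in>{..<j} - {i}. l ((x(i := a)) i')) = (\<Prod>i'\<in>{..<j} - {i}. l (x i'))"
    by (rule prod.cong) auto
  finally show ?thesis .
qed

text \<open>The multilinear map is the product of \<open>l\<close> over all slots, times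
  \<open>w\<close>. With scalar \<open>w\<close> it serves the Moebius expansion, with
  \<open>w = 0\<close> the zero terms of the Schwarz mappings.\<close>

lemma homogeneous_polynomial_power:
  assumes l: "bounded_linear l" "\<And>c x. l (c *\<^sub>C x) = c * l x"
  shows "homogeneous_polynomial j (\<lambda>x. l x ^ j *\<^sub>C w)"
proof -
  define u where "u x = (\<Prod>i<j. l (x i)) *\<^sub>C w" for x
  have upd: "u (x(i := a)) = (l a * (\<Prod>i'\<in>{..<j} - {i}. l (x i'))) *\<^sub>C w" if "i < j" for x i a
    unfolding u_def prod_fun_upd[OF that] ..
  have "continuous_on ({..<j} \<rightarrow>\<^sub>E UNIV) (\<lambda>x. l (x i))" for i
    by (rule bounded_linear.continuous_on[OF l(1)])
      (rule continuous_on_subset[OF continuous_on_product_coordinates], simp)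
  then have "continuous_on ({..<j} \<rightarrow>\<^sub>E UNIV) u"
    unfolding u_def
    by (intro bounded_bilinear.continuous_on[OF bounded_bilinear_scaleC] continuous_on_prod
        continuous_on_const)
  then have "continuous_multilinear j u"
    unfolding continuous_multilinear_def
    by (simp add: upd l(2) linear_add[OF bounded_linear.linear[OF l(1)]] scaleC_scaleC
        mult.assoc distrib_right flip: scaleC_add_left)
  then show ?thesis
    unfolding homogeneous_polynomial_def by (intro exI[of _ u]) (simp add: u_def)
qed

lemma homogeneous_polynomial_power_id:
  fixes l :: "'a::complex_normed_vector \<Rightarrow> complex"
  assumes l: "bounded_linear l" "\<And>c x. l (c *\<^sub>C x) = c * l x"
  shows "homogeneous_polynomial (Suc j) (\<lambda>x. l x ^ j *\<^sub>C x)"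
proof -
  \<comment> \<open>Slots below \<open>j\<close> pass through \<open>l\<close>; the last slot
    \<open>j\<close> carries the vector.\<close>
  define u where "u x = (\<Prod>i<j. l (x i)) *\<^sub>C (x j :: 'a)" for x
  have upd: "u (x(i := a)) = (l a * (\<Prod>i'\<in>{..<j} - {i}. l (x i'))) *\<^sub>C x j" if "i < j" for x i a
    unfolding u_def prod_fun_upd[OF that] using that by simp
  have upd_last: "u (x(j := a)) = (\<Prod>i<j. l (x i)) *\<^sub>C a" for x a
  proof -
    have "(\<Prod>i<j. l ((x(j := a)) i)) = (\<Prod>i<j. l (x i))" by (rule prod.cong) auto
    then show ?thesis by (simp add: u_def)
  qed
  have coord: "continuous_on ({..<Suc j} \<rightarrow>\<^sub>E UNIV) (\<lambda>x :: nat \<Rightarrow> 'a. x i)" for i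
    by (rule continuous_on_subset[OF continuous_on_product_coordinates]) simp
  then have "continuous_on ({..<Suc j} \<rightarrow>\<^sub>E UNIV) (\<lambda>x. l (x i))" for i
    by (rule bounded_linear.continuous_on[OF l(1)])
  then have "continuous_on ({..<Suc j} \<rightarrow>\<^sub>E UNIV) u"
    unfolding u_def
    by (intro bounded_bilinear.continuous_on[OF bounded_bilinear_scaleC] continuous_on_prod coord)
  moreover have "u (x(i := a + b)) = u (x(i := a)) + u (x(i := b))
      \<and> u (x(i := c *\<^sub>C a)) = c *\<^sub>C u (x(i := a))" if "i < Suc j" for x i a b c
  proof (cases "i = j")
    case True
    then show ?thesis by (simp add: upd_last scaleC_add_right scaleC_scaleC mult.commute)
  next
    case False
    then have "i < j" using that by simp
    then show ?thesis
      by (simp add: upd l(2) linear_add[OF bounded_linear.linear[OF l(1)]] scaleC_scaleC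
          mult.assoc distrib_right flip: scaleC_add_left)
  qed
  ultimately have "continuous_multilinear (Suc j) u"
    unfolding continuous_multilinear_def by blast
  then show ?thesis
    unfolding homogeneous_polynomial_def by (intro exI[of _ u]) (simp add: u_def)
qed

lemma Schwarz_mapping_power:
  fixes l :: "'a::complex_normed_vector \<Rightarrow> complex"
  assumes l: "bounded_linear l" "\<And>c x. l (c *\<^sub>C x) = c * l x" "\<And>x. cmod (l x) \<le> norm x"
    and v: "l v \<noteq> 0"
  shows "schwarz_mapping (\<lambda>z. l z ^ n *\<^sub>C z)" "zero_of_order (\<lambda>z. l z ^ n *\<^sub>C z) (Suc n)"
proof -
  show "schwarz_mapping (\<lambda>z. l z ^ n *\<^sub>C z)"
    unfolding schwarz_mapping_def
  proof (intro conjI)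
    show "holomorphic_map_on (\<lambda>z. l z ^ n *\<^sub>C z) (ball 0 1)"
      unfolding holomorphic_map_on_def
    proof (intro ballI exI conjI allI)
      fix x :: 'a
      have "(l has_derivative l) (at x)" by (rule bounded_linear_imp_has_derivative[OF l(1)])
      then have "((\<lambda>z. l z ^ n) has_derivative (\<lambda>h. of_nat n * l h * l x ^ (n - 1))) (at x)"
        by (rule has_derivative_power)
      then show "((\<lambda>z. l z ^ n *\<^sub>C z) has_derivative
          (\<lambda>h. l x ^ n *\<^sub>C h + (of_nat n * l h * l x ^ (n - 1)) *\<^sub>C x)) (at x)"
        by (rule bounded_bilinear.FDERIV[OF bounded_bilinear_scaleC _ has_derivative_ident])
      show "l x ^ n *\<^sub>C (c *\<^sub>C h) + (of_nat n * l (c *\<^sub>C h) * l x ^ (n - 1)) *\<^sub>C x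
          = c *\<^sub>C (l x ^ n *\<^sub>C h + (of_nat n * l h * l x ^ (n - 1)) *\<^sub>C x)" for c h
        by (simp add: l(2) scaleC_add_right scaleC_scaleC mult_ac)
    qed
    show "(\<lambda>z. l z ^ n *\<^sub>C z) ` ball 0 1 \<subseteq> ball 0 1"
    proof (rule image_subsetI)
      fix z :: 'a assume z: "z \<in> ball 0 1"
      then have "cmod (l z) \<le> 1" using l(3)[of z] by simp
      then have "cmod (l z) ^ n * norm z \<le> norm z" by (simp add: mult_left_le_one_le power_le_one)
      then show "l z ^ n *\<^sub>C z \<in> ball 0 1" using z by (simp add: norm_scaleC norm_power)
    qed
  qed simp
  \<comment> \<open>The factor \<open>z\<close> adds one to the degree, so the only nonzero term has
    degree \<open>Suc n\<close>.\<close>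
  define Q where "Q j z = (if j = Suc n then l z ^ n *\<^sub>C z else 0)" for j z
  have "homogeneous_polynomial j (Q j)" for j
    using homogeneous_polynomial_power_id[OF l(1,2), of n] homogeneous_polynomial_power[OF l(1,2), of j 0]
    by (cases "j = Suc n") (auto simp: Q_def[abs_def])
  moreover have "(\<lambda>j. Q j z) sums (l z ^ n *\<^sub>C z)" for z
    using sums_single[of "Suc n" "\<lambda>_. l z ^ n *\<^sub>C z"] by (simp add: Q_def)
  moreover have "Q (Suc n) v \<noteq> 0"
  proof
    assume "Q (Suc n) v = 0"
    then have "l (l v ^ n *\<^sub>C v) = l 0" by (simp add: Q_def)
    then show False using v by (simp add: l(2) linear_0[OF bounded_linear.linear[OF l(1)]])
  qed
  ultimately show "zero_of_order (\<lambda>z. l z ^ n *\<^sub>C z) (Suc n)"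
    unfolding zero_of_order_def homogeneous_expansion_def
    by (intro exI[of _ Q] conjI) (auto simp: Q_def)
qed

text \<open>Taylor coefficients of \<open>(a + w) / (1 + a * w) = a + (1 - a\<^sup>2) * w / (1 + a *
  w)\<close>; the factor \<open>w\<close> shifts the geometric series, whence the exponent
  \<open>j - 1\<close>.\<close>

definition Moebius_coeff :: "real \<Rightarrow> nat \<Rightarrow> complex"
  where "Moebius_coeff a j = (if j = 0 then of_real a else of_real ((1 - a\<^sup>2) * (- a) ^ (j - 1)))"

lemma Moebius_coeff_sums:
  assumes a: "0 < a" "a < 1" and w: "cmod w < 1"
  shows "(\<lambda>j. Moebius_coeff a j * w ^ j) sums ((of_real a + w) / (1 + of_real a * w))"
proof -
  let ?a = "of_real a :: complex"
  have aw: "cmod (- ?a * w) < 1"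
    using mult_strict_mono[of a 1 "cmod w" 1] a w by (simp add: norm_mult)
  then have ne: "1 + ?a * w \<noteq> 0"
  proof -
    have "- ?a * w \<noteq> 1" using aw by (metis norm_one order_less_irrefl)
    then show ?thesis by algebra
  qed
  have "(\<lambda>j. (1 - ?a\<^sup>2) * w * (- ?a * w) ^ j) sums ((1 - ?a\<^sup>2) * w / (1 + ?a * w))"
    using sums_mult[OF geometric_sums[OF aw], of "(1 - ?a\<^sup>2) * w"] by simp
  moreover have "(1 - ?a\<^sup>2) * w * (- ?a * w) ^ j = Moebius_coeff a (Suc j) * w ^ Suc j" for j
    unfolding power_mult_distrib by (simp add: Moebius_coeff_def)
  ultimately have "(\<lambda>j. Moebius_coeff a (Suc j) * w ^ Suc j) sums ((1 - ?a\<^sup>2) * w / (1 + ?a * w))"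
    by (simp only:)
  then have "(\<lambda>j. Moebius_coeff a j * w ^ j) sums ((1 - ?a\<^sup>2) * w / (1 + ?a * w) + ?a)"
    by (subst (asm) sums_Suc_iff) (simp add: Moebius_coeff_def)
  also have "(1 - ?a\<^sup>2) * w / (1 + ?a * w) + ?a = (?a + w) / (1 + ?a * w)"
    using ne by (simp add: divide_simps) (simp add: algebra_simps power2_eq_square)
  finally show ?thesis .
qed

lemma Moebius_admissible:
  fixes l :: "'a::complex_banach \<Rightarrow> complex"
  assumes l: "bounded_linear l" "\<And>c x. l (c *\<^sub>C x) = c * l x" "\<And>x. cmod (l x) \<le> norm x"
    and v: "l v \<noteq> 0" and a: "0 < a" "a < 1"
  shows "admissible (\<lambda>z. (of_real a + l z) / (1 + of_real a * l z))
    (\<lambda>j z. Moebius_coeff a j * l z ^ j) (\<lambda>n z. l z ^ (n - 1) *\<^sub>C z)"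
  unfolding admissible_def
proof (intro conjI allI impI)
  let ?a = "of_real a :: complex"
  \<comment> \<open>The Moebius inequality with centre \<open>- a\<close>; it also keeps the
    denominator away from 0.\<close>
  have less: "cmod (?a + w) < cmod (1 + ?a * w)" if "cmod w < 1" for w
    using Moebius_less[of "- ?a" w] a that by (simp add: add.commute)
  have lz: "cmod (l z) < 1" if "z \<in> ball 0 1" for z using that l(3)[of z] by simp
  show "holomorphic_map_on (\<lambda>z. (?a + l z) / (1 + ?a * l z)) (ball 0 1)"
    unfolding holomorphic_map_on_def
  proof (intro ballI)
    fix x :: 'a assume "x \<in> ball 0 1"
    then have "1 + ?a * l x \<noteq> 0" using less[OF lz] norm_ge_zero by fastforce
    then have "(\<lambda>w. (?a + w) / (1 + ?a * w)) field_differentiable (at (l x))"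
      by (auto intro!: derivative_intros)
    then obtain d where "((\<lambda>w. (?a + w) / (1 + ?a * w)) has_derivative (*) d) (at (l x))"
      by (auto simp: field_differentiable_def has_field_derivative_def)
    then have "((\<lambda>z. (?a + l z) / (1 + ?a * l z)) has_derivative (\<lambda>h. d * l h)) (at x)"
      by (rule has_derivative_compose[OF bounded_linear_imp_has_derivative[OF l(1)]])
    then show "\<exists>L. ((\<lambda>z. (?a + l z) / (1 + ?a * l z)) has_derivative L) (at x) \<and>
        (\<forall>c h. L (c *\<^sub>C h) = c *\<^sub>C L h)"
      by (intro exI[of _ "\<lambda>h. d * l h"]) (simp add: l(2) scaleC_complex_def)
  qed
  show "(\<lambda>z. (?a + l z) / (1 + ?a * l z)) ` ball 0 1 \<subseteq> ball 0 1"
  proof (rule image_subsetI)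
    fix z :: 'a assume "z \<in> ball 0 1"
    then have *: "cmod (?a + l z) < cmod (1 + ?a * l z)" by (intro less lz)
    then have "0 < cmod (1 + ?a * l z)" using norm_ge_zero order_le_less_trans by blast
    then show "(?a + l z) / (1 + ?a * l z) \<in> ball 0 1" using * by (simp add: norm_divide)
  qed
  have "homogeneous_polynomial j (\<lambda>z. Moebius_coeff a j * l z ^ j)" for j
    using homogeneous_polynomial_power[OF l(1,2), of j "Moebius_coeff a j"]
    by (simp add: scaleC_complex_def mult.commute)
  then show "homogeneous_expansion (\<lambda>z. (?a + l z) / (1 + ?a * l z)) (\<lambda>j z. Moebius_coeff a j * l z ^ j)"
    unfolding homogeneous_expansion_def using Moebius_coeff_sums[OF a lz] by auto
  fix n :: nat assume "1 \<le> n"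
  then have n: "Suc (n - 1) = n" by simp
  show "schwarz_mapping (\<lambda>z. l z ^ (n - 1) *\<^sub>C z)" by (rule Schwarz_mapping_power[OF l v])
  show "zero_of_order (\<lambda>z. l z ^ (n - 1) *\<^sub>C z) n"
    using Schwarz_mapping_power(2)[OF l v, of "n - 1"] unfolding n .
qed

text \<open>To first order at \<open>a = 1\<close>, the value of \<open>H\<close> for the Moebius map with parameter \<open>a\<close> is
  \<open>1 + (1 - a) * Psi2\<close>.\<close>

lemma Moebius_value_gt_1:
  assumes r: "0 < r" "r < 1" and k: "0 < k" and s: "0 < s" and p: "0 < p"
    and Psi: "0 < Psi2 p m k lam s t r"
  obtains a where "0 < a" "a < 1"
    "1 < ((a + r ^ m) / (1 + a * r ^ m)) powr p
      + lam * ((1 - a\<^sup>2) * (a ^ (s + t - 1) * r ^ (k * (s + t)) / (1 - a ^ s * r ^ (k * s))))"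
proof -
  define \<rho> where "\<rho> = r ^ m"
  define q where "q = r ^ (k * (s + t))"
  define \<sigma> where "\<sigma> = r ^ (k * s)"
  have \<rho>: "0 < \<rho>" and \<sigma>: "\<sigma> < 1" using r k s by (auto simp: \<rho>_def \<sigma>_def power_less_one_iff)
  define X where "X a = (a + \<rho>) / (1 + a * \<rho>)" for a
  define M where "M a = a ^ (s + t - 1) * q / (1 - a ^ s * \<sigma>)" for a
  define h where "h a = X a powr p + lam * ((1 - a\<^sup>2) * M a)" for a
  have X1: "X 1 = 1" using \<rho> by (simp add: X_def)
  have M1: "M 1 = q / (1 - \<sigma>)" by (simp add: M_def)
  have X': "(X has_real_derivative (1 - \<rho>) / (1 + \<rho>)) (at 1)"
    unfolding X_def using \<rho>
    by (auto intro!: derivative_eq_intros simp: divide_simps) (simp add: algebra_simps)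
  \<comment> \<open>The factor \<open>1 - a\<^sup>2\<close> vanishes at 1, so the value of
    \<open>M'\<close> drops out of the derivative of \<open>h\<close>.\<close>
  have "(\<lambda>a. M a) differentiable (at 1)"
    unfolding M_def using \<sigma> by (intro derivative_intros) auto
  then obtain M' where M': "(M has_real_derivative M') (at 1)"
    by (auto simp: real_differentiable_def)
  \<comment> \<open>This derivative is \<open>- Psi2\<close> at \<open>r\<close>; being negative, it
    makes \<open>h\<close> exceed \<open>h 1 = 1\<close> just to the left of 1.\<close>
  have "(h has_real_derivative p * ((1 - \<rho>) / (1 + \<rho>)) - 2 * lam * M 1) (at 1)"
    unfolding h_def by (auto intro!: derivative_eq_intros X' M' simp: X1)
  moreover have "p * ((1 - \<rho>) / (1 + \<rho>)) - 2 * lam * M 1 < 0"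
    using Psi by (simp add: Psi2_def M1 \<rho>_def q_def \<sigma>_def)
  ultimately obtain d where d: "0 < d" "\<And>e. 0 < e \<Longrightarrow> e < d \<Longrightarrow> h 1 < h (1 - e)"
    using DERIV_neg_dec_left by blast
  define e where "e = min (d / 2) (1 / 2)"
  have e: "0 < e" "e < d" "e < 1" using d(1) by (auto simp: e_def)
  have "1 < h (1 - e)" using d(2)[OF e(1,2)] by (simp add: h_def X1)
  then show thesis
    using e by (intro that[of "1 - e"]) (simp_all add: h_def X_def M_def \<rho>_def q_def \<sigma>_def)
qed

text \<open>At \<open>z = r v\<close> the Schwarz bounds are attained, as
  \<open>l (\<mu> n z) = r ^ n\<close>. Taking moduli removes the alternating signs of the Moebius
  coefficients, so \<open>H\<close> equals the expression bounded below in
  \<open>Moebius_value_gt_1\<close>.\<close>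

lemma Bohr_sharp:
  assumes nontrivial: "(UNIV :: 'a::complex_banach set) \<noteq> {0}"
    and k: "0 < k" and m: "0 < m" and s: "0 < s" and p: "0 < p"
    and r: "0 < r" "r < 1" and Psi: "0 < Psi2 p m k lam s t r"
  shows "\<exists>f P \<mu> (z :: 'a). admissible f P \<mu> \<and> norm z = r \<and>
    summable (H_summand k s t P \<mu> z) \<and> 1 < H p m k lam s t f P \<mu> z"
proof -
  obtain y :: 'a where y: "y \<noteq> 0" using nontrivial by auto
  define v where "v = inverse (norm y) *\<^sub>R y"
  have v: "norm v = 1" using y by (simp add: v_def)
  obtain l :: "'a \<Rightarrow> complex" where l: "bounded_linear l" "\<And>c x. l (c *\<^sub>C x) = c * l x"
      "\<And>x. cmod (l x) \<le> norm x" and lv: "l v = of_real (norm v)"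
    by (rule norming_functional[of v]) (rule that; assumption)
  obtain a where a: "0 < a" "a < 1" and gt: "1 < ((a + r ^ m) / (1 + a * r ^ m)) powr p
      + lam * ((1 - a\<^sup>2) * (a ^ (s + t - 1) * r ^ (k * (s + t)) / (1 - a ^ s * r ^ (k * s))))"
    by (rule Moebius_value_gt_1[OF r k s p Psi])
  define f where "f z = (of_real a + l z) / (1 + of_real a * l z)" for z
  define P where "P j z = Moebius_coeff a j * l z ^ j" for j z
  define \<mu> where "\<mu> n z = l z ^ (n - 1) *\<^sub>C z" for n :: nat and z
  have adm: "admissible f P \<mu>"
    unfolding f_def P_def \<mu>_def by (rule Moebius_admissible[OF l _ a, of v]) (simp add: lv v)
  define z where "z = r *\<^sub>R v"
  have lz: "l z = of_real r"
    by (simp add: z_def linear_scale[OF bounded_linear.linear[OF l(1)]] lv v scaleR_conv_of_real)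
  have l\<mu>: "l (\<mu> n z) = of_real (r ^ n)" if "0 < n" for n
    using that by (simp add: \<mu>_def l(2) lz power_eq_if[of _ n] mult.commute)
  have "f (\<mu> m z) = of_real ((a + r ^ m) / (1 + a * r ^ m))"
    by (simp add: f_def l\<mu>[OF m])
  moreover have "0 < (a + r ^ m) / (1 + a * r ^ m)"
    using a r by (intro divide_pos_pos add_pos_pos mult_pos_pos zero_less_power) auto
  ultimately have fm: "cmod (f (\<mu> m z)) = (a + r ^ m) / (1 + a * r ^ m)"
    by (simp only: norm_of_real abs_of_pos)
  define q where "q = a ^ s * r ^ (k * s)"
  have q: "0 \<le> q" "q < 1"
    using a r s k mult_strict_mono[of "a ^ s" 1 "r ^ (k * s)" 1] by (auto simp: q_def power_less_one_iff)
  have "H_summand k s t P \<mu> z j = (1 - a\<^sup>2) * a ^ (s + t - 1) * r ^ (k * (s + t)) * q ^ j" for j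
  proof -
    have e: "s * Suc j + t - 1 = s + t - 1 + s * j" using s by simp
    have "H_summand k s t P \<mu> z j = \<bar>1 - a\<^sup>2\<bar> * a ^ (s * Suc j + t - 1) * (r ^ k) ^ (s * Suc j + t)"
      using s a r by (simp add: H_summand_def P_def Moebius_coeff_def l\<mu>[OF k] norm_mult norm_power abs_mult power_abs
          del: of_real_power of_real_diff of_real_mult mult_Suc_right)
    also have "\<bar>1 - a\<^sup>2\<bar> = 1 - a\<^sup>2" using a by (simp add: power_le_one)
    also have "a ^ (s * Suc j + t - 1) = a ^ (s + t - 1) * (a ^ s) ^ j"
      unfolding e by (simp add: power_add power_mult)
    also have "(r ^ k) ^ (s * Suc j + t) = r ^ (k * (s + t)) * (r ^ (k * s)) ^ j"
      by (simp add: algebra_simps flip: power_add power_mult)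
    finally show ?thesis by (simp add: q_def power_mult_distrib mult_ac)
  qed
  then have "H_summand k s t P \<mu> z =
      (\<lambda>j. (1 - a\<^sup>2) * a ^ (s + t - 1) * r ^ (k * (s + t)) * q ^ j)"
    by (rule ext)
  moreover have "(\<lambda>j. (1 - a\<^sup>2) * a ^ (s + t - 1) * r ^ (k * (s + t)) * q ^ j)
      sums ((1 - a\<^sup>2) * a ^ (s + t - 1) * r ^ (k * (s + t)) * (1 / (1 - q)))"
    using q by (intro sums_mult geometric_sums) simp
  ultimately have "H_summand k s t P \<mu> z sums
      ((1 - a\<^sup>2) * (a ^ (s + t - 1) * r ^ (k * (s + t)) / (1 - q)))"
    by (simp add: mult.assoc)
  then have "summable (H_summand k s t P \<mu> z)" "1 < H p m k lam s t f P \<mu> z"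
    using gt by (auto simp: H_def fm sums_iff q_def)
  moreover have "norm z = r" using r v by (simp add: z_def)
  ultimately show ?thesis using adm by blast
qed

text \<open>Unique existence of the root is asserted because \<open>R2\<close> is a definite
  description, and summability because \<open>H\<close> contains an infinite sum.\<close>

theorem theorem8:
  fixes k m s t :: nat and p lam :: real
  assumes "(UNIV :: 'a::complex_banach set) \<noteq> {0}"
    and "1 \<le> k" and "1 \<le> m" and "0 < t" and "t < s"
    and "0 < p" and "p \<le> 2" and "0 < lam"
  shows "(\<exists>!r. 0 < r \<and> r < 1 \<and> Psi2 p m k lam s t r = 0) \<and>
    (\<forall>f P \<mu> (z :: 'a). admissible f P \<mu> \<longrightarrow> norm z \<le> R2 p m k lam s t \<longrightarrow>
      summable (H_summand k s t P \<mu> z) \<and> H p m k lam s t f P \<mu> z \<le> 1) \<and>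
    ((\<exists>\<epsilon>>0. \<forall>r\<in>{R2 p m k lam s t<..<R2 p m k lam s t + \<epsilon>}. 0 < Psi2 p m k lam s t r) \<longrightarrow>
      (\<forall>R. R2 p m k lam s t < R \<and> R < 1 \<longrightarrow>
        (\<exists>f P \<mu> (z :: 'a). admissible f P \<mu> \<and> z \<in> ball 0 1 \<and> norm z \<le> R \<and>
          summable (H_summand k s t P \<mu> z) \<and> 1 < H p m k lam s t f P \<mu> z)))"
proof (intro conjI allI impI)
  have pos: "0 < k" "0 < m" "0 < s" using assms by auto
  show root: "\<exists>!r. 0 < r \<and> r < 1 \<and> Psi2 p m k lam s t r = 0"
    by (rule Psi2_root[OF pos assms(6,8)])
  define \<rho> where "\<rho> = R2 p m k lam s t"
  have \<rho>: "0 < \<rho>" "\<rho> < 1" "Psi2 p m k lam s t \<rho> = 0"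
    using theI'[OF root] by (auto simp: R2_def \<rho>_def)
  note mono = Psi2_strict_mono[OF _ _ _ pos assms(6,8)]
  {
    fix f :: "'a \<Rightarrow> complex" and P \<mu> and z :: 'a
    assume adm: "admissible f P \<mu>" and "norm z \<le> R2 p m k lam s t"
    then have z: "norm z \<le> \<rho>" by (simp add: \<rho>_def)
    have "Psi2 p m k lam s t (norm z) \<le> 0"
      using mono[of "norm z" \<rho> t] \<rho> z by (cases "norm z = \<rho>") auto
    moreover have "norm z < 1" using z \<rho> by simp
    ultimately show "summable (H_summand k s t P \<mu> z)" "H p m k lam s t f P \<mu> z \<le> 1"
      using Bohr_bound[OF adm pos assms(6,7,8)] by blast+
  }
  fix R assume "R2 p m k lam s t < R \<and> R < 1"
  then have R: "\<rho> < R" "R < 1" by (auto simp: \<rho>_def)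
  \<comment> \<open>Strict monotonicity makes \<open>Psi2\<close> positive at \<open>R\<close>, so a
    counterexample exists on the sphere of radius \<open>R\<close> itself.\<close>
  then have "0 < Psi2 p m k lam s t R" using mono[of \<rho> R t] \<rho> by simp
  then have "\<exists>f P \<mu> (z :: 'a). admissible f P \<mu> \<and> norm z = R \<and>
      summable (H_summand k s t P \<mu> z) \<and> 1 < H p m k lam s t f P \<mu> z"
    using R \<rho> by (intro Bohr_sharp[OF assms(1) pos assms(6)]) auto
  then show "\<exists>f P \<mu> (z :: 'a). admissible f P \<mu> \<and> z \<in> ball 0 1 \<and> norm z \<le> R \<and>
      summable (H_summand k s t P \<mu> z) \<and> 1 < H p m k lam s t f P \<mu> z"
    using R by (metis mem_ball_0 order_refl)
qed

end
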